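(* Let $A^+ \subset (2\mathbb{N})^n$ and $A^- \subset \mathbb{N}^n$ be finite disjoint sets and let $A = A^+ \cup A^-$. Let $$f(x) = \sum_{\sigma \in S_n} \ \sum_{\beta \in A^-} \ \sum_{(C^+,\beta) \in \mathcal{C}(A^+,\beta)} f^{\sigma}_{(C^+,\beta)}(x)$$ be a symmetric polynomial supported on $\Sigma(A)$, where each $$f^{\sigma}_{(C^+,\beta)}(x) = \sum_{\alpha \in C^+} c_\alpha^{(C^+,\beta)}\, x^{\sigma(\alpha)} + c_\beta^{(C^+,\beta)}\, x^{\sigma(\beta)}$$ is a circuit polynomial or the zero polynomial, with real coefficients $c_\alpha^{(C^+,\beta)}, c_\beta^{(C^+,\beta)}$ not depending on $\sigma$ and with $c_\beta^{(C^+,\beta)} \le 0$. For $\beta \in A^-$ and $(C^+,\beta) \in \mathcal{C}(A^+,\beta)$, let $(\lambda_\alpha^{(C^+,\beta)})_{\alpha \in C^+}$ be the unique barycentric coordinates of $\beta$ with respect to $C^+$. Then, for each such $(C^+,\beta)$, the following two conditions are equivalent: 1. for all $x \in \mathbb{R}^n_{\ge 0}$, $$\sum_{\sigma \in S_n} \left|c_\beta^{(C^+,\beta)}\right| x^{\sigma(\beta)} \ \le \ \sum_{\sigma \in S_n} \ \prod_{\alpha \in C^+} \left(\frac{c_\alpha^{(C^+,\beta)}}{\lambda_\alpha^{(C^+,\beta)}}\right)^{\lambda_\alpha^{(C^+,\beta)}} x^{\sigma(\beta)};$$ 2. $$\left|c_\beta^{(C^+,\beta)}\right| \ \le \ \prod_{\alpha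 \in C^+} \left(\frac{c_\alpha^{(C^+,\beta)}}{\lambda_\alpha^{(C^+,\beta)}}\right)^{\lambda_\alpha^{(C^+,\beta)}} .$$ Moreover, if one of these equivalent conditions holds for every $\beta \in A^-$ and every $(C^+,\beta) \in \mathcal{C}(A^+,\beta)$, then $f$ is nonnegative, i.e. $f(x) \ge 0$ for all $x \in \mathbb{R}^n$.
   Context: $\mathbb{N}$ contains $0$, and $S_n$ is the symmetric group on $\{1,\dots,n\}$. For $\gamma \in \mathbb{N}^n$ and $\sigma \in S_n$ write $\sigma(\gamma) = (\gamma_{\sigma(1)},\dots,\gamma_{\sigma(n)})$ and $x^{\sigma(\gamma)} = x_1^{\gamma_{\sigma(1)}}\cdots x_n^{\gamma_{\sigma(n)}}$; for a set $A$ let $\Sigma(A) = \{\sigma(\gamma) : \sigma \in S_n,\ \gamma \in A\}$. A polynomial is supported on a set $B$ if every exponent with nonzero coefficient lies in $B$. A circuit polynomial is a polynomial $\sum_{\alpha \in C^+} c_\alpha x^\alpha + c_\beta x^\beta \in \mathbb{R}[x_1,\dots,x_n]$ such that $c_\alpha > 0$ for all $\alpha \in C^+$, $c_\beta \in \mathbb{R}$, $C^+ \subset (2\mathbb{N})^n$ is the vertex set of a simplex (i.e. finite, nonempty and affinely independent), and $\beta \in \mathbb{N}^n$ lies in the relative interior of $\operatorname{conv}(C^+)$. For finite $A^+ \subset (2\mathbb{N})^n$ and $\beta \in \mathbb{N}^n \setminus A^+$, $\mathcal{C}(A^+,\beta)$ is the set of all circuits over $A^+$ with inner point $\beta$: the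 pairs $(C^+,\beta)$ with $C^+ \subseteq A^+$ affinely independent and $\beta \in \operatorname{relint}(\operatorname{conv}(C^+))$. The barycentric coordinates of $\beta$ with respect to $C^+$ are the unique $\lambda_\alpha \in (0,1)$, $\alpha \in C^+$, with $\sum_{\alpha} \lambda_\alpha = 1$ and $\beta = \sum_{\alpha \in C^+} \lambda_\alpha \alpha$. *)

theory Defs
  imports "HOL-Analysis.Analysis" "HOL-Library.Poly_Mapping"
begin

text \<open>
  Variables are indexed by a finite type \<open>'n\<close>, so \<open>S\<^sub>n\<close> is the set of all \<open>\<sigma>\<close> with
  \<open>\<sigma> permutes UNIV\<close>.  A real polynomial is the finitely supported map from exponent vectors
  to coefficients; \<open>Poly_Mapping.single \<gamma> a\<close> is the term \<open>a x\<^sup>\<gamma>\<close>.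
\<close>

type_synonym 'n exponent = "(nat, 'n) vec"
type_synonym 'n polynomial = "(nat, 'n) vec \<Rightarrow>\<^sub>0 real"

definition monomial_value :: "real ^ 'n \<Rightarrow> 'n::finite exponent \<Rightarrow> real" where
  "monomial_value x \<gamma> = (\<Prod>i\<in>UNIV. (x $ i) ^ (\<gamma> $ i))"

definition poly_value :: "'n::finite polynomial \<Rightarrow> real ^ 'n \<Rightarrow> real" where
  "poly_value p x = (\<Sum>\<gamma>\<in>Poly_Mapping.keys p. Poly_Mapping.lookup p \<gamma> * monomial_value x \<gamma>)"

definition perm_exponent :: "('n \<Rightarrow> 'n) \<Rightarrow> 'n::finite exponent \<Rightarrow> 'n exponent" where
  "perm_exponent \<sigma> \<gamma> = (\<chi> i. \<gamma> $ \<sigma> i)"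

definition perm_orbit :: "'n::finite exponent set \<Rightarrow> 'n exponent set" where
  "perm_orbit A = {perm_exponent \<sigma> \<gamma> | \<sigma> \<gamma>. \<sigma> permutes UNIV \<and> \<gamma> \<in> A}"

text \<open>Permuting the variables of a polynomial permutes the exponents of its terms, so invariance
  under \<open>S\<^sub>n\<close> says that coefficients are constant on orbits of exponents.\<close>

definition symmetric_polynomial :: "'n::finite polynomial \<Rightarrow> bool" where
  "symmetric_polynomial p \<longleftrightarrow>
    (\<forall>\<sigma> \<gamma>. \<sigma> permutes UNIV \<longrightarrow>
      Poly_Mapping.lookup p (perm_exponent \<sigma> \<gamma>) = Poly_Mapping.lookup p \<gamma>)"

definition supported_on :: "'n::finite polynomial \<Rightarrow> 'n exponent set \<Rightarrow> bool" where
  "supported_on p B \<longleftrightarrow> Poly_Mapping.keys p \<subseteq> B"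

definition even_exponents :: "'n::finite exponent set" where
  "even_exponents = {\<gamma>. \<forall>i. even (\<gamma> $ i)}"

definition real_exponent :: "'n::finite exponent \<Rightarrow> real ^ 'n" where
  "real_exponent \<gamma> = (\<chi> i. real (\<gamma> $ i))"

definition is_circuit :: "'n::finite exponent set \<Rightarrow> 'n exponent \<Rightarrow> bool" where
  "is_circuit C \<beta> \<longleftrightarrow>
    finite C \<and> C \<noteq> {} \<and> C \<subseteq> even_exponents \<and>
    \<not> affine_dependent (real_exponent ` C) \<and>
    real_exponent \<beta> \<in> rel_interior (convex hull (real_exponent ` C))"

text \<open>A circuit polynomial, with its circuit \<open>(C, \<beta>)\<close> made explicit.\<close>

definition circuit_polynomial ::
    "'n::finite exponent set \<Rightarrow> 'n exponent \<Rightarrow> 'n polynomial \<Rightarrow> bool" where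
  "circuit_polynomial C \<beta> p \<longleftrightarrow>
    is_circuit C \<beta> \<and>
    (\<exists>a b. (\<forall>\<alpha>\<in>C. a \<alpha> > 0) \<and>
      p = (\<Sum>\<alpha>\<in>C. Poly_Mapping.single \<alpha> (a \<alpha>)) + Poly_Mapping.single \<beta> b)"

definition circuits ::
    "'n::finite exponent set \<Rightarrow> 'n exponent \<Rightarrow> ('n exponent set \<times> 'n exponent) set" where
  "circuits A \<beta> = {(C, \<beta>) | C. C \<subseteq> A \<and> is_circuit C \<beta>}"

text \<open>The last clause only normalises the values outside \<open>C\<close>, so that the coordinates are
  unique as a total function.\<close>

definition barycentric_coordinates ::
    "'n::finite exponent set \<Rightarrow> 'n exponent \<Rightarrow> ('n exponent \<Rightarrow> real) \<Rightarrow> bool" where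
  "barycentric_coordinates C \<beta> l \<longleftrightarrow>
    (\<forall>\<alpha>\<in>C. 0 < l \<alpha> \<and> l \<alpha> < 1) \<and>
    (\<Sum>\<alpha>\<in>C. l \<alpha>) = 1 \<and>
    real_exponent \<beta> = (\<Sum>\<alpha>\<in>C. l \<alpha> *\<^sub>R real_exponent \<alpha>) \<and>
    (\<forall>\<alpha>. \<alpha> \<notin> C \<longrightarrow> l \<alpha> = 0)"

definition barycentric ::
    "'n::finite exponent set \<times> 'n exponent \<Rightarrow> 'n exponent \<Rightarrow> real" where
  "barycentric K = (THE l. barycentric_coordinates (fst K) (snd K) l)"

lemma inj_real_exponent: "inj real_exponent"
  by (auto simp: inj_on_def real_exponent_def vec_eq_iff)

text \<open>The hypothesis \<open>\<beta> \<notin> C\<close> excludes the one-point circuit, whose coordinate is \<open>1\<close>.\<close>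

lemma barycentric_coordinates_ex1:
  assumes "is_circuit C \<beta>" "\<beta> \<notin> C"
  shows "\<exists>!l. barycentric_coordinates C \<beta> l"
proof (rule ex_ex1I)
  let ?r = "real_exponent"
  have fin: "finite C" and indep: "\<not> affine_dependent (?r ` C)"
    and ri: "?r \<beta> \<in> rel_interior (convex hull (?r ` C))"
    using assms by (auto simp: is_circuit_def)
  have inj: "inj_on ?r C" using inj_real_exponent by (rule inj_on_subset) simp
  obtain u where u: "\<forall>x\<in>?r ` C. 0 < u x" "sum u (?r ` C) = 1"
    "(\<Sum>x\<in>?r ` C. u x *\<^sub>R x) = ?r \<beta>"
    using ri unfolding rel_interior_convex_hull_explicit[OF indep] by auto
  define l where "l \<alpha> = (if \<alpha> \<in> C then u (?r \<alpha>) else 0)" for \<alpha>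
  have pos: "0 < l \<alpha>" if "\<alpha> \<in> C" for \<alpha> using u(1) that by (simp add: l_def)
  have s1: "sum l C = 1" using u(2) inj by (simp add: l_def sum.reindex)
  have s2: "?r \<beta> = (\<Sum>\<alpha>\<in>C. l \<alpha> *\<^sub>R ?r \<alpha>)"
    using u(3) inj by (simp add: l_def sum.reindex)
  have lt1: "l \<alpha> < 1" if a: "\<alpha> \<in> C" for \<alpha>
  proof (rule ccontr)
    assume "\<not> l \<alpha> < 1"
    moreover have "sum l C = l \<alpha> + sum l (C - {\<alpha>})"
      using fin a by (simp add: sum.remove)
    ultimately have le: "sum l (C - {\<alpha>}) \<le> 0" using s1 by linarith
    have "C - {\<alpha>} = {}"
    proof (rule ccontr)
      assume "C - {\<alpha>} \<noteq> {}"
      then have "0 < sum l (C - {\<alpha>})" using fin pos by (intro sum_pos) auto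
      then show False using le by simp
    qed
    then have "C = {\<alpha>}" using a by auto
    then have "?r \<beta> = ?r \<alpha>" using s1 s2 by simp
    then have "\<beta> = \<alpha>" using inj_real_exponent by (auto dest: injD)
    then show False using a assms(2) by simp
  qed
  show "\<exists>l. barycentric_coordinates C \<beta> l"
    using pos lt1 s1 s2 by (intro exI[of _ l]) (auto simp: barycentric_coordinates_def l_def)
next
  let ?r = "real_exponent"
  fix l m
  assume l: "barycentric_coordinates C \<beta> l" and m: "barycentric_coordinates C \<beta> m"
  have fin: "finite C" and indep: "\<not> affine_dependent (?r ` C)"
    using assms by (auto simp: is_circuit_def)
  have inj: "inj_on ?r C" using inj_real_exponent by (rule inj_on_subset) simp
  define U where "U x = l (inv_into C ?r x) - m (inv_into C ?r x)" for x
  have U: "U (?r \<alpha>) = l \<alpha> - m \<alpha>" if "\<alpha> \<in> C" for \<alpha>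
    using inj that by (simp add: U_def)
  have "sum U (?r ` C) = 0"
    using l m inj U by (simp add: sum.reindex barycentric_coordinates_def sum_subtractf)
  moreover have "(\<Sum>x\<in>?r ` C. U x *\<^sub>R x) = 0"
  proof -
    have "(\<Sum>x\<in>?r ` C. U x *\<^sub>R x) = (\<Sum>\<alpha>\<in>C. (l \<alpha> - m \<alpha>) *\<^sub>R ?r \<alpha>)"
      using inj U by (simp add: sum.reindex)
    also have "\<dots> = ?r \<beta> - ?r \<beta>"
      using l m by (simp add: barycentric_coordinates_def scaleR_diff_left sum_subtractf)
    finally show ?thesis by simp
  qed
  ultimately have "\<forall>v\<in>?r ` C. U v = 0"
    using indep affine_dependent_explicit_finite[of "?r ` C"] fin by auto
  then have "\<forall>\<alpha>\<in>C. l \<alpha> = m \<alpha>" using U by auto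
  then show "l = m" using l m by (metis barycentric_coordinates_def ext)
qed

end

theory Submission
  imports Defs
begin

text \<open>
  On the nonnegative orthant the monomials \<open>x\<^bsup>\<sigma>(\<gamma>)\<^esup>\<close> are nonnegative and all equal
  \<open>1\<close> at \<open>x = (1, \<dots>, 1)\<close>, so the inequality between orbit sums is equivalent to the
  inequality between their coefficients.  Since the exponents in \<open>C\<close> are even and the inner
  coefficient is nonpositive, a circuit polynomial can only decrease when \<open>x\<close> is replaced
  by \<open>\<bar>x\<bar>\<close>; there the weighted AM-GM inequality, with weights the barycentric coordinates
  of \<open>\<beta>\<close>, bounds the outer terms below by the circuit number times \<open>\<bar>x\<bar>\<^bsup>\<sigma>(\<beta>)\<^esup>\<close>.
  Thus every summand of \<open>f\<close> is nonnegative.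
\<close>

text \<open>Jensen's inequality for the convex function \<open>exp\<close> at the points
  \<open>ln (t i)\<close>. A vanishing \<open>t i\<close> has no usable logarithm and is treated
  first: the product is then 0, because \<open>0 powr w = 0\<close>.\<close>

lemma weighted_arith_geom_mean:
  fixes w t :: "'a \<Rightarrow> real"
  assumes fin: "finite S" and w: "\<And>i. i \<in> S \<Longrightarrow> 0 < w i" "sum w S = 1"
    and t: "\<And>i. i \<in> S \<Longrightarrow> 0 \<le> t i"
  shows "(\<Prod>i\<in>S. t i powr w i) \<le> (\<Sum>i\<in>S. w i * t i)"
proof (cases "\<exists>i\<in>S. t i = 0")
  case True
  then have "(\<Prod>i\<in>S. t i powr w i) = 0"
    using fin by (auto simp: prod_zero_iff)
  also have "0 \<le> (\<Sum>i\<in>S. w i * t i)"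
    using w t by (intro sum_nonneg) (simp add: less_imp_le)
  finally show ?thesis .
next
  case False
  have "S \<noteq> {}"
    using w(2) by auto
  have "(\<Prod>i\<in>S. t i powr w i) = exp (\<Sum>i\<in>S. w i *\<^sub>R ln (t i))"
    using False fin by (auto simp: exp_sum powr_def intro!: prod.cong)
  also have "\<dots> \<le> (\<Sum>i\<in>S. w i * exp (ln (t i)))"
    using w by (intro convex_on_sum[OF fin \<open>S \<noteq> {}\<close> exp_convex]) (auto simp: less_imp_le)
  also have "\<dots> = (\<Sum>i\<in>S. w i * t i)"
    using False t by (intro sum.cong) (auto simp: less_le)
  finally show ?thesis .
qed

lemma poly_value_0 [simp]: "poly_value 0 x = 0"
  by (simp add: poly_value_def)

lemma poly_value_single [simp]: "poly_value (Poly_Mapping.single \<gamma> a) x = a * monomial_value x \<gamma>"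
  by (simp add: poly_value_def)

lemma poly_value_add: "poly_value (p + q) x = poly_value p x + poly_value q x"
  unfolding poly_value_def
  by (rule setsum_keys_plus_distrib[of "\<lambda>\<gamma> a. a * monomial_value x \<gamma>"])
    (simp_all add: distrib_right)

lemma poly_value_sum: "poly_value (\<Sum>i\<in>I. p i) x = (\<Sum>i\<in>I. poly_value (p i) x)"
  by (induction I rule: infinite_finite_induct) (simp_all add: poly_value_add)

lemma monomial_value_nonneg: "(\<And>i. 0 \<le> x $ i) \<Longrightarrow> 0 \<le> monomial_value x \<gamma>"
  by (simp add: monomial_value_def prod_nonneg)

lemma monomial_value_one: "monomial_value (\<chi> i. 1) \<gamma> = 1"
  by (simp add: monomial_value_def)

lemma monomial_value_abs: "monomial_value (\<chi> i. \<bar>x $ i\<bar>) \<gamma> = \<bar>monomial_value x \<gamma>\<bar>"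
  by (simp add: monomial_value_def abs_prod power_abs)

lemma monomial_value_even: "\<gamma> \<in> even_exponents \<Longrightarrow> 0 \<le> monomial_value x \<gamma>"
  by (auto simp: monomial_value_def even_exponents_def intro!: prod_nonneg zero_le_even_power)

lemma perm_exponent_inj: "\<sigma> permutes UNIV \<Longrightarrow> inj (perm_exponent \<sigma>)"
  by (rule injI) (metis perm_exponent_def permutes_univ vec_eq_iff vec_lambda_beta)

lemma perm_exponent_even: "\<gamma> \<in> even_exponents \<Longrightarrow> perm_exponent \<sigma> \<gamma> \<in> even_exponents"
  by (simp add: even_exponents_def perm_exponent_def)

text \<open>One-variable core of the next lemma: for positive \<open>t\<close> the exponents of
  \<open>powr\<close> simply add up. The point \<open>t = 0\<close> is separate, since there
  \<open>0 ^ 0 = 1\<close> has to match on both sides.\<close>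

lemma power_convex_combination:
  fixes t :: real and l :: "'a \<Rightarrow> real" and e :: "'a \<Rightarrow> nat"
  assumes fin: "finite C" and l: "\<And>\<alpha>. \<alpha> \<in> C \<Longrightarrow> 0 < l \<alpha>" and t: "0 \<le> t"
    and m: "real m = (\<Sum>\<alpha>\<in>C. l \<alpha> * real (e \<alpha>))"
  shows "(\<Prod>\<alpha>\<in>C. (t ^ e \<alpha>) powr l \<alpha>) = t ^ m"
proof (cases "t = 0")
  case True
  \<comment> \<open>A sum of nonnegative terms vanishes only termwise. As the weights are positive,
    either every exponent is 0 and both sides are 1, or some exponent is positive and both sides are
    0.\<close>
  have "m = 0 \<longleftrightarrow> (\<forall>\<alpha>\<in>C. l \<alpha> * real (e \<alpha>) = 0)"
    using m fin l by (subst sum_nonneg_eq_0_iff[symmetric]) (auto simp: less_imp_le)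
  then have "m = 0 \<longleftrightarrow> (\<forall>\<alpha>\<in>C. e \<alpha> = 0)"
    using l by fastforce
  then show ?thesis
    using True fin by (cases "m = 0") (auto simp: power_0_left prod_zero_iff)
next
  case False
  with t have "0 < t" by simp
  then have "(\<Prod>\<alpha>\<in>C. (t ^ e \<alpha>) powr l \<alpha>) = (\<Prod>\<alpha>\<in>C. t powr (l \<alpha> * real (e \<alpha>)))"
    by (intro prod.cong) (simp_all add: powr_realpow[symmetric] powr_powr mult.commute)
  also have "\<dots> = t powr (\<Sum>\<alpha>\<in>C. l \<alpha> * real (e \<alpha>))"
    using \<open>0 < t\<close> fin by (simp add: powr_sum)
  finally show ?thesis
    using \<open>0 < t\<close> by (simp flip: m add: powr_realpow)
qed

text \<open>The weighted geometric mean of the outer monomials is the inner monomial. Permuting acts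
  on all exponents alike, so the weights for the unpermuted circuit serve every \<sigma>: variable
  \<open>i\<close> uses the entry \<open>\<sigma> i\<close> of the barycentric relation.\<close>

lemma monomial_value_convex_combination:
  assumes "finite C" and "\<And>\<alpha>. \<alpha> \<in> C \<Longrightarrow> 0 < l \<alpha>"
    and \<beta>: "real_exponent \<beta> = (\<Sum>\<alpha>\<in>C. l \<alpha> *\<^sub>R real_exponent \<alpha>)"
    and x: "\<And>i. 0 \<le> x $ i"
  shows "(\<Prod>\<alpha>\<in>C. monomial_value x (perm_exponent \<sigma> \<alpha>) powr l \<alpha>)
    = monomial_value x (perm_exponent \<sigma> \<beta>)"
proof -
  have "real (\<beta> $ j) = (\<Sum>\<alpha>\<in>C. l \<alpha> * real (\<alpha> $ j))" for j
    using arg_cong[OF \<beta>, of "\<lambda>v. v $ j"] by (simp add: real_exponent_def)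
  then have "(\<Prod>\<alpha>\<in>C. ((x $ i) ^ (\<alpha> $ \<sigma> i)) powr l \<alpha>) = (x $ i) ^ (\<beta> $ \<sigma> i)" for i
    using assms by (intro power_convex_combination) auto
  moreover have "(\<Prod>\<alpha>\<in>C. monomial_value x (perm_exponent \<sigma> \<alpha>) powr l \<alpha>)
      = (\<Prod>\<alpha>\<in>C. \<Prod>i\<in>UNIV. ((x $ i) ^ (\<alpha> $ \<sigma> i)) powr l \<alpha>)"
    using x by (simp add: monomial_value_def perm_exponent_def prod_powr_distrib)
  ultimately show ?thesis
    by (simp add: prod.swap[of _ UNIV C] monomial_value_def perm_exponent_def)
qed

lemma circuit_value_nonneg:
  fixes x :: "real ^ 'n::finite"
  assumes circuit: "is_circuit C \<beta>" "\<beta> \<notin> C"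
    and bary: "barycentric_coordinates C \<beta> l"
    and a: "\<And>\<alpha>. \<alpha> \<in> C \<Longrightarrow> 0 < a \<alpha>" and b: "b \<le> 0"
    and bound: "\<bar>b\<bar> \<le> (\<Prod>\<alpha>\<in>C. (a \<alpha> / l \<alpha>) powr l \<alpha>)"
  shows "0 \<le> (\<Sum>\<alpha>\<in>C. a \<alpha> * monomial_value x (perm_exponent \<sigma> \<alpha>))
    + b * monomial_value x (perm_exponent \<sigma> \<beta>)"
proof -
  define y :: "real ^ 'n" where "y = (\<chi> i. \<bar>x $ i\<bar>)"
  let ?m = "\<lambda>\<gamma>. monomial_value y (perm_exponent \<sigma> \<gamma>)"
  have y: "0 \<le> y $ i" for i
    by (simp add: y_def)
  have fin: "finite C" and even: "C \<subseteq> even_exponents"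
    using circuit by (auto simp: is_circuit_def)
  have l: "\<And>\<alpha>. \<alpha> \<in> C \<Longrightarrow> 0 < l \<alpha>" "sum l C = 1"
    "real_exponent \<beta> = (\<Sum>\<alpha>\<in>C. l \<alpha> *\<^sub>R real_exponent \<alpha>)"
    using bary by (auto simp: barycentric_coordinates_def)
  \<comment> \<open>Even exponents stay even under permutation, so replacing \<open>x\<close> by
    \<open>y\<close> leaves the outer terms unchanged; only the inner term can differ.\<close>
  have outer: "monomial_value x (perm_exponent \<sigma> \<alpha>) = ?m \<alpha>" if "\<alpha> \<in> C" for \<alpha>
    using that even by (simp add: y_def monomial_value_abs monomial_value_even perm_exponent_even subsetD)
  have "- b * monomial_value x (perm_exponent \<sigma> \<beta>) \<le> \<bar>b\<bar> * ?m \<beta>"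
    unfolding y_def monomial_value_abs using b by (simp add: mult_left_mono_neg)
  also have "\<dots> \<le> (\<Prod>\<alpha>\<in>C. (a \<alpha> / l \<alpha>) powr l \<alpha>) * ?m \<beta>"
    by (intro mult_right_mono bound monomial_value_nonneg y)
  also have "\<dots> = (\<Prod>\<alpha>\<in>C. (a \<alpha> / l \<alpha>) powr l \<alpha> * ?m \<alpha> powr l \<alpha>)"
    using monomial_value_convex_combination[OF fin l(1,3) y] by (simp add: prod.distrib)
  also have "\<dots> = (\<Prod>\<alpha>\<in>C. (a \<alpha> / l \<alpha> * ?m \<alpha>) powr l \<alpha>)"
    using a l(1) by (intro prod.cong refl powr_mult[symmetric])
  \<comment> \<open>The division by \<open>l \<alpha>\<close> in the circuit number is chosen so
    that the weights of the arithmetic mean cancel in the next step.\<close>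
  also have "\<dots> \<le> (\<Sum>\<alpha>\<in>C. l \<alpha> * (a \<alpha> / l \<alpha> * ?m \<alpha>))"
    using a l by (intro weighted_arith_geom_mean fin)
      (auto intro!: mult_nonneg_nonneg divide_nonneg_nonneg monomial_value_nonneg y simp: less_imp_le)
  also have "\<dots> = (\<Sum>\<alpha>\<in>C. a \<alpha> * ?m \<alpha>)"
    using l(1) by (intro sum.cong) (force simp: less_imp_neq)+
  also have "\<dots> = (\<Sum>\<alpha>\<in>C. a \<alpha> * monomial_value x (perm_exponent \<sigma> \<alpha>))"
    using outer by simp
  finally show ?thesis
    by simp
qed

text \<open>Injectivity of \<open>g\<close> together with \<open>\<beta> \<notin> C\<close> keeps
  all exponents distinct, so no other term contributes to the coefficient at
  \<open>g \<alpha>\<close>.\<close>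

lemma lookup_sum_single_image:
  assumes "finite C" "inj g" "\<alpha> \<in> C" "\<beta> \<notin> C"
  shows "Poly_Mapping.lookup ((\<Sum>\<gamma>\<in>C. Poly_Mapping.single (g \<gamma>) (a \<gamma>)) + Poly_Mapping.single (g \<beta>) b) (g \<alpha>)
    = a \<alpha>"
proof -
  have "(\<Sum>\<gamma>\<in>C. Poly_Mapping.lookup (Poly_Mapping.single (g \<gamma>) (a \<gamma>)) (g \<alpha>)) =
      (\<Sum>\<gamma>\<in>C. if \<gamma> = \<alpha> then a \<gamma> else 0)"
    using assms(2) by (intro sum.cong) (auto simp: lookup_single when_def inj_eq)
  moreover have "g \<beta> \<noteq> g \<alpha>"
    using assms by (auto simp: inj_eq)
  ultimately show ?thesis
    using assms by (simp add: lookup_add lookup_sum lookup_single)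
qed

text \<open>\<open>circuit_polynomial\<close> only asserts that some positive coefficients exist;
  comparing coefficients identifies them with the given \<open>c\<close>.\<close>

lemma circuit_polynomial_coeff_pos:
  assumes \<sigma>: "\<sigma> permutes UNIV" and C: "finite C" "\<beta> \<notin> C" "\<alpha> \<in> C"
    and p: "circuit_polynomial (perm_exponent \<sigma> ` C) (perm_exponent \<sigma> \<beta>)
      ((\<Sum>\<alpha>\<in>C. Poly_Mapping.single (perm_exponent \<sigma> \<alpha>) (c \<alpha>)) +
        Poly_Mapping.single (perm_exponent \<sigma> \<beta>) b)"
  shows "0 < c \<alpha>"
proof -
  note inj = perm_exponent_inj[OF \<sigma>]
  obtain a b' where a: "\<forall>\<gamma>\<in>perm_exponent \<sigma> ` C. 0 < a \<gamma>"
    and eq: "(\<Sum>\<alpha>\<in>C. Poly_Mapping.single (perm_exponent \<sigma> \<alpha>) (c \<alpha>)) +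
        Poly_Mapping.single (perm_exponent \<sigma> \<beta>) b
      = (\<Sum>\<gamma>\<in>perm_exponent \<sigma> ` C. Poly_Mapping.single \<gamma> (a \<gamma>)) +
        Poly_Mapping.single (perm_exponent \<sigma> \<beta>) b'"
    using p by (auto simp: circuit_polynomial_def)
  have "c \<alpha> = a (perm_exponent \<sigma> \<alpha>)"
    \<comment> \<open>Both representations are read off at the same exponent; composing
      \<open>a\<close> with the permutation turns the sum over the image of \<open>C\<close> into a
      sum over \<open>C\<close>.\<close>
    using lookup_sum_single_image[OF C(1) inj C(3,2), of c b]
      lookup_sum_single_image[OF C(1) inj C(3,2), of "a \<circ> perm_exponent \<sigma>" b'] eq inj
    by (simp add: sum.reindex inj_on_subset)
  then show ?thesis
    using a C(3) by simp
qed

lemma orbit_sum_le_iff: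
  fixes \<beta> :: "'n::finite exponent"
  shows "(\<forall>x :: real ^ 'n. (\<forall>i. 0 \<le> x $ i) \<longrightarrow>
      (\<Sum>\<sigma> | \<sigma> permutes UNIV. a * monomial_value x (perm_exponent \<sigma> \<beta>))
      \<le> (\<Sum>\<sigma> | \<sigma> permutes UNIV. b * monomial_value x (perm_exponent \<sigma> \<beta>))) \<longleftrightarrow> a \<le> b"
    (is "?L \<longleftrightarrow> _")
proof
  let ?P = "{\<sigma>. \<sigma> permutes (UNIV :: 'n set)}"
  assume ?L
  from this[rule_format, of "\<chi> i. 1"] have "real (card ?P) * a \<le> real (card ?P) * b"
    by (simp add: monomial_value_one)
  \<comment> \<open>Positivity of the number of permutations allows it to be cancelled.\<close>
  moreover have "0 < card ?P"
    by (simp add: card_permutations)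
  ultimately show "a \<le> b"
    by simp
next
  assume "a \<le> b"
  then show ?L
    by (auto intro!: sum_mono mult_right_mono monomial_value_nonneg)
qed

theorem corollary4p2:
  fixes Ap Am :: "(nat ^ 'n::finite) set"
    and f :: "(nat ^ 'n) \<Rightarrow>\<^sub>0 real"
    and F :: "('n \<Rightarrow> 'n) \<Rightarrow> (nat ^ 'n) set \<times> (nat ^ 'n) \<Rightarrow> ((nat ^ 'n) \<Rightarrow>\<^sub>0 real)"
    and c :: "(nat ^ 'n) set \<times> (nat ^ 'n) \<Rightarrow> nat ^ 'n \<Rightarrow> real"
  assumes "finite Ap" and "finite Am" and "Ap \<inter> Am = {}"
    and "Ap \<subseteq> even_exponents"
    and "f = (\<Sum>\<sigma> | \<sigma> permutes UNIV. \<Sum>\<beta>\<in>Am. \<Sum>K\<in>circuits Ap \<beta>. F \<sigma> K)"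
    and "symmetric_polynomial f"
    and "supported_on f (perm_orbit (Ap \<union> Am))"
    and "\<And>\<sigma> \<beta> C. \<sigma> permutes UNIV \<Longrightarrow> \<beta> \<in> Am \<Longrightarrow> (C, \<beta>) \<in> circuits Ap \<beta> \<Longrightarrow>
      F \<sigma> (C, \<beta>) =
        (\<Sum>\<alpha>\<in>C. Poly_Mapping.single (perm_exponent \<sigma> \<alpha>) (c (C, \<beta>) \<alpha>)) +
        Poly_Mapping.single (perm_exponent \<sigma> \<beta>) (c (C, \<beta>) \<beta>)"
    and "\<And>\<sigma> \<beta> C. \<sigma> permutes UNIV \<Longrightarrow> \<beta> \<in> Am \<Longrightarrow> (C, \<beta>) \<in> circuits Ap \<beta> \<Longrightarrow>
      circuit_polynomial (perm_exponent \<sigma> ` C) (perm_exponent \<sigma> \<beta>) (F \<sigma> (C, \<beta>)) \<or>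
      F \<sigma> (C, \<beta>) = 0"
    and "\<And>\<beta> C. \<beta> \<in> Am \<Longrightarrow> (C, \<beta>) \<in> circuits Ap \<beta> \<Longrightarrow> c (C, \<beta>) \<beta> \<le> 0"
  shows "(\<forall>\<beta>\<in>Am. \<forall>C. (C, \<beta>) \<in> circuits Ap \<beta> \<longrightarrow>
      (\<forall>x :: real ^ 'n. (\<forall>i. 0 \<le> x $ i) \<longrightarrow>
        (\<Sum>\<sigma> | \<sigma> permutes UNIV. \<bar>c (C, \<beta>) \<beta>\<bar> * monomial_value x (perm_exponent \<sigma> \<beta>))
        \<le> (\<Sum>\<sigma> | \<sigma> permutes UNIV.
            (\<Prod>\<alpha>\<in>C. (c (C, \<beta>) \<alpha> / barycentric (C, \<beta>) \<alpha>) powr barycentric (C, \<beta>) \<alpha>) *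
            monomial_value x (perm_exponent \<sigma> \<beta>)))
      \<longleftrightarrow>
      \<bar>c (C, \<beta>) \<beta>\<bar>
        \<le> (\<Prod>\<alpha>\<in>C. (c (C, \<beta>) \<alpha> / barycentric (C, \<beta>) \<alpha>) powr barycentric (C, \<beta>) \<alpha>))
    \<and>
    ((\<forall>\<beta>\<in>Am. \<forall>C. (C, \<beta>) \<in> circuits Ap \<beta> \<longrightarrow>
      (\<forall>x :: real ^ 'n. (\<forall>i. 0 \<le> x $ i) \<longrightarrow>
        (\<Sum>\<sigma> | \<sigma> permutes UNIV. \<bar>c (C, \<beta>) \<beta>\<bar> * monomial_value x (perm_exponent \<sigma> \<beta>))
        \<le> (\<Sum>\<sigma> | \<sigma> permutes UNIV.
            (\<Prod>\<alpha>\<in>C. (c (C, \<beta>) \<alpha> / barycentric (C, \<beta>) \<alpha>) powr barycentric (C, \<beta>) \<alpha>) *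
            monomial_value x (perm_exponent \<sigma> \<beta>)))
      \<or>
      \<bar>c (C, \<beta>) \<beta>\<bar>
        \<le> (\<Prod>\<alpha>\<in>C. (c (C, \<beta>) \<alpha> / barycentric (C, \<beta>) \<alpha>) powr barycentric (C, \<beta>) \<alpha>))
     \<longrightarrow> (\<forall>x :: real ^ 'n. 0 \<le> poly_value f x))"
proof -
  have poly_value_f: "0 \<le> poly_value f x"
    if bound: "\<And>\<beta> C. \<beta> \<in> Am \<Longrightarrow> (C, \<beta>) \<in> circuits Ap \<beta> \<Longrightarrow>
      \<bar>c (C, \<beta>) \<beta>\<bar>
        \<le> (\<Prod>\<alpha>\<in>C. (c (C, \<beta>) \<alpha> / barycentric (C, \<beta>) \<alpha>) powr barycentric (C, \<beta>) \<alpha>)"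
    for x :: "real ^ 'n"
  proof -
    have "0 \<le> poly_value (F \<sigma> K) x"
      if \<sigma>: "\<sigma> permutes UNIV" and \<beta>: "\<beta> \<in> Am" and K: "K \<in> circuits Ap \<beta>" for \<sigma> \<beta> K
    \<comment> \<open>A zero summand is trivially nonnegative; a nonzero one is a circuit
      polynomial, which yields the positivity of its outer coefficients.\<close>
    proof (cases "F \<sigma> K = 0")
      case False
      obtain C where KC: "K = (C, \<beta>)" and "C \<subseteq> Ap" and circ: "is_circuit C \<beta>"
        using K by (auto simp: circuits_def)
      \<comment> \<open>Disjointness of \<open>Ap\<close> and \<open>Am\<close> rules out the
        one-point circuit, so the barycentric coordinates exist, are unique, and the definite
        description is meaningful.\<close>
      have nin: "\<beta> \<notin> C"
        using \<open>C \<subseteq> Ap\<close> \<beta> assms(3) by auto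
      have fin: "finite C"
        using circ by (simp add: is_circuit_def)
      note C = K[unfolded KC]
      have "barycentric_coordinates C \<beta> (barycentric K)"
        unfolding barycentric_def KC using theI'[OF barycentric_coordinates_ex1[OF circ nin]] by simp
      moreover have "0 < c K \<alpha>" if "\<alpha> \<in> C" for \<alpha>
        using assms(9)[OF \<sigma> \<beta> C] False
        unfolding KC assms(8)[OF \<sigma> \<beta> C]
        by (auto intro: circuit_polynomial_coeff_pos[OF \<sigma> fin nin that])
      ultimately have "0 \<le> (\<Sum>\<alpha>\<in>C. c K \<alpha> * monomial_value x (perm_exponent \<sigma> \<alpha>))
          + c K \<beta> * monomial_value x (perm_exponent \<sigma> \<beta>)"
        using circ nin assms(10)[OF \<beta> C] bound[OF \<beta> C] unfolding KC
        by (intro circuit_value_nonneg)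
      then show ?thesis
        unfolding KC assms(8)[OF \<sigma> \<beta> C] by (simp add: poly_value_add poly_value_sum)
    qed simp
    then show ?thesis
      unfolding assms(5) poly_value_sum by (intro sum_nonneg) blast
  qed
  show ?thesis
    \<comment> \<open>The rewriting turns condition 1 into condition 2, so the equivalence becomes
      trivial and the disjunction collapses to the bound that \<open>poly_value_f\<close>
      assumes.\<close>
    unfolding orbit_sum_le_iff using poly_value_f by blast
qed

end
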